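(* Let $p$ be an odd prime and $q$ a power of $p$. Fix $\alpha\in\mathbb{F}_{q^2}\setminus\mathbb{F}_q$ such that $\operatorname{Tr}^{q^2}_q(\alpha)=0$. Let $b_1,b_2,c\in\mathbb{F}_q$ and $b=b_1+b_2\alpha\in\mathbb{F}_{q^2}$. Define $$\Delta=b_2^2-\frac{c^2+4cb_1}{4\alpha^{q+1}}\in\mathbb{F}_q .$$ Let $N(b,c)$ be the number of $x\in\mu_{q+1}\setminus\{-1\}$ with $\operatorname{Tr}^{q^2}_q(bx+b)+c=0$. Then $N(b,c)$ is equal to (i) $q$, if $b=0$, $c=0$; (ii) $0$, if $b=0$, $c\neq 0$; (iii) $0$, if $b\neq 0$, $c=0$, $b_2=0$; (iv) $1$, if $b\neq 0$, $c=0$, $b_2\neq 0$; (v) $1$, if $b\neq 0$, $c\neq 0$, $\Delta=0$; (vi) $0$, if $b\neq 0$, $c\neq 0$, and $\Delta\in\mathbb{F}_q^*$ is not a square in $\mathbb{F}_q^*$; (vii) $2$, if $b\neq 0$, $c\neq 0$, and $\Delta$ is a square in $\mathbb{F}_q^*$.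
   Context: $\mathbb{F}_r$ is the finite field with $r$ elements and $\mathbb{F}_r^*$ its multiplicative group. $\operatorname{Tr}^{q^2}_q:\mathbb{F}_{q^2}\to\mathbb{F}_q$ is $\operatorname{Tr}^{q^2}_q(x)=x+x^q$. $\mu_{q+1}=\{x\in\mathbb{F}_{q^2}:x^{q+1}=1\}$. Every element of $\mathbb{F}_{q^2}$ is uniquely of the form $b_1+b_2\alpha$ with $b_1,b_2\in\mathbb{F}_q$, and $\alpha^{q+1}\in\mathbb{F}_q^*$. *)

theory Defs
  imports "HOL-Computational_Algebra.Computational_Algebra"
begin

definition is_subfield :: "'a::field set \<Rightarrow> bool" where
  "is_subfield K \<longleftrightarrow>
     0 \<in> K \<and> 1 \<in> K \<and>
     (\<forall>x\<in>K. \<forall>y\<in>K. x + y \<in> K \<and> x * y \<in> K) \<and>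
     (\<forall>x\<in>K. - x \<in> K \<and> inverse x \<in> K)"

definition Tr :: "nat \<Rightarrow> 'a::field \<Rightarrow> 'a" where
  "Tr q x = x + x ^ q"

definition mu :: "nat \<Rightarrow> 'a::field set" where
  "mu n = {x. x ^ n = 1}"

definition N :: "nat \<Rightarrow> 'a::field \<Rightarrow> 'a \<Rightarrow> nat" where
  "N q b c = card {x \<in> mu (q + 1) - {- 1}. Tr q (b * x + b) + c = 0}"

(* Squares are taken inside the units of K: when K has q elements, every element
   of K is already a square in the field with q^2 elements. *)

definition is_unit_square :: "'a::field set \<Rightarrow> 'a \<Rightarrow> bool" where
  "is_unit_square K d \<longleftrightarrow> (\<exists>y \<in> K - {0}. d = y ^ 2)"

end

theory Submission
  imports Defs "HOL-Number_Theory.Residues"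
begin

text \<open>
  As \<open>\<alpha>\<^sup>q = -\<alpha>\<close>, the Cayley map \<open>t \<mapsto> (1 + t\<alpha>) / (1 - t\<alpha>)\<close> is a bijection from
  \<open>\<bbbF>\<^sub>q\<close> onto \<open>\<mu>\<^bsub>q+1\<^esub> - {-1}\<close>, and with \<open>D = \<alpha>\<^sup>2\<close> it turns the trace equation into
  \<open>c D t\<^sup>2 - 4 b\<^sub>2 D t - (4 b\<^sub>1 + c) = 0\<close> over \<open>\<bbbF>\<^sub>q\<close>. For \<open>c \<noteq> 0\<close>, completing the square
  with \<open>s = (c t - 2 b\<^sub>2) / 2\<close> gives \<open>s\<^sup>2 = \<Delta>\<close>.
\<close>

section \<open>Finite subfields as fixed points of a power map\<close>

text \<open>Multiplication by a nonzero \<open>x\<close> permutes the nonzero elements of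
  \<open>K\<close>. Their product is therefore unchanged, and cancelling it leaves
  \<open>x ^ (card K - 1) = 1\<close>.\<close>

lemma subfield_power_card:
  fixes K :: "'a::{field,finite} set"
  assumes "is_subfield K" and "x \<in> K"
  shows "x ^ card K = x"
proof (cases "x = 0")
  case True
  have "card K > 0" using assms by (auto simp: card_gt_0_iff)
  with True show ?thesis by (simp add: zero_power)
next
  case False
  let ?U = "K - {0}"
  have mul: "\<And>y z. y \<in> K \<Longrightarrow> z \<in> K \<Longrightarrow> y * z \<in> K" and inv: "inverse x \<in> K" and "0 \<in> K"
    using assms by (auto simp: is_subfield_def)
  have "bij_betw ((*) x) ?U ?U"
    by (rule bij_betwI[where g = "(*) (inverse x)"])
       (use False assms mul inv in \<open>auto simp: field_simps\<close>)
  hence "(\<Prod>y\<in>?U. y) = (\<Prod>y\<in>?U. x * y)"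
    by (rule prod.reindex_bij_betw[symmetric])
  also have "\<dots> = x ^ card ?U * (\<Prod>y\<in>?U. y)"
    by (simp add: prod.distrib)
  finally have "x ^ card ?U = 1" by simp
  moreover have "card K = Suc (card ?U)"
    using \<open>0 \<in> K\<close> by (metis card_Suc_Diff1 finite_code)
  ultimately show ?thesis by simp
qed

text \<open>The polynomial X^|K| - X has at most |K| roots, and \<open>K\<close> already supplies
  that many. Membership in \<open>K\<close> thereby becomes an equation that Frobenius can
  test.\<close>

lemma subfield_eq_fixed_points:
  fixes K :: "'a::{field,finite} set"
  assumes "is_subfield K"
  shows "K = {x. x ^ card K = x}"
proof (rule card_subset_eq)
  show "K \<subseteq> {x. x ^ card K = x}"
    using subfield_power_card[OF assms] by auto
  let ?P = "Polynomial.monom 1 (card K) - Polynomial.monom 1 1 :: 'a poly"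
  \<comment> \<open>For \<open>card K = 1\<close> the two monomials of \<open>?P\<close> would
    cancel; the elements 0 and 1 exclude this.\<close>
  have "card {0, 1 :: 'a} \<le> card K"
    using assms by (intro card_mono) (auto simp: is_subfield_def)
  hence K: "card K > 1" by simp
  hence "Polynomial.coeff ?P (card K) = 1" by simp
  hence "?P \<noteq> 0" by (metis coeff_0 zero_neq_one)
  hence "card {x. poly ?P x = 0} \<le> degree ?P" by (rule card_poly_roots_bound)
  also have "degree ?P \<le> card K"
    using K by (intro degree_diff_le) (auto simp: degree_monom_eq)
  finally have "card {x :: 'a. x ^ card K = x} \<le> card K" by (simp add: poly_monom)
  moreover have "card K \<le> card {x :: 'a. x ^ card K = x}"
    by (rule card_mono) (use subfield_power_card[OF assms] in auto)
  ultimately show "card K = card {x :: 'a. x ^ card K = x}" by simp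
qed auto

lemma CHAR_eq_of_card_prime_power:
  assumes "prime p" and "card (UNIV :: 'a::{field,finite} set) = p ^ n"
  shows "CHAR('a) = p"
proof -
  have "CHAR('a) > 0" by (rule finite_imp_CHAR_pos) simp
  hence "prime CHAR('a)" by (rule prime_CHAR_semidom)
  moreover have "CHAR('a) dvd p ^ n" using CHAR_dvd_CARD[where ?'a = 'a] assms by simp
  ultimately show ?thesis
    using assms by (metis prime_dvd_power primes_dvd_imp_eq)
qed

text \<open>Roots come in pairs \<open>y\<close>, \<open>- y\<close>, distinct because 2 is nonzero.
  A root of a nonzero \<open>d\<close> is itself nonzero, hence witnesses
  \<open>is_unit_square\<close>.\<close>

lemma card_square_roots:
  fixes K :: "'a::field set" and d :: 'a
  assumes "is_subfield K" and "(2::'a) \<noteq> 0"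
  shows "d = 0 \<Longrightarrow> card {s \<in> K. s ^ 2 = d} = 1"
    and "d \<noteq> 0 \<Longrightarrow> \<not> is_unit_square K d \<Longrightarrow> card {s \<in> K. s ^ 2 = d} = 0"
    and "is_unit_square K d \<Longrightarrow> card {s \<in> K. s ^ 2 = d} = 2"
proof -
  assume "d = 0"
  hence "{s \<in> K. s ^ 2 = d} = {0}" using assms by (auto simp: is_subfield_def)
  thus "card {s \<in> K. s ^ 2 = d} = 1" by simp
next
  assume "d \<noteq> 0" "\<not> is_unit_square K d"
  hence "{s \<in> K. s ^ 2 = d} = {}" by (auto simp: is_unit_square_def)
  thus "card {s \<in> K. s ^ 2 = d} = 0" by (simp only: card.empty)
next
  assume "is_unit_square K d"
  then obtain y where y: "y \<in> K" "y \<noteq> 0" "d = y ^ 2" by (auto simp: is_unit_square_def)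
  hence "{s \<in> K. s ^ 2 = d} = {y, - y}"
    using assms by (auto simp: power2_eq_iff is_subfield_def)
  moreover have "y \<noteq> - y"
  proof
    assume "y = - y"
    hence "2 * y = 0" by (metis add.right_inverse mult_2)
    thus False using y assms by simp
  qed
  ultimately show "card {s \<in> K. s ^ 2 = d} = 2" by simp
qed

section \<open>Arithmetic of the fixed field and conjugation of \<alpha>\<close>

text \<open>With \<open>K\<close> given as the fixed set of an additive q-th power map, closure
  properties become equations. The condition on \<open>\<alpha> ^ q\<close> is the vanishing of the
  trace.\<close>

locale frobenius_field =
  fixes q :: nat and K :: "'a::field set" and \<alpha> :: 'a
  assumes K_eq: "K = {x. x ^ q = x}"
    and frobenius_add: "\<And>x y :: 'a. (x + y) ^ q = x ^ q + y ^ q"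
    and odd_q: "odd q"
    and two_nonzero: "(2::'a) \<noteq> 0"
    and \<alpha>_notin: "\<alpha> \<notin> K"
    and \<alpha>_power: "\<alpha> ^ q = - \<alpha>"
begin

lemma frobenius_diff: "(x - y :: 'a) ^ q = x ^ q - y ^ q"
  using frobenius_add[of x "- y"] odd_q by simp

lemma two_in: "2 \<in> K"
  using frobenius_add[of 1 1] by (simp add: K_eq)

lemma four_nonzero: "(4::'a) \<noteq> 0"
  using two_nonzero by (metis mult_2 no_zero_divisors numeral_Bit0)

lemma four_in: "4 \<in> K"
  using frobenius_add[of 2 2] two_in by (simp add: K_eq)

lemma arith_in:
  assumes "x \<in> K" "y \<in> K"
  shows "x + y \<in> K" "x - y \<in> K" "x * y \<in> K" "x / y \<in> K"
  using assms
  by (auto simp: K_eq frobenius_add frobenius_diff power_mult_distrib power_divide)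

lemma uminus_in: "x \<in> K \<Longrightarrow> - x \<in> K"
  using odd_q by (simp add: K_eq)

lemma power_in: "x \<in> K \<Longrightarrow> x ^ n \<in> K"
  by (simp add: K_eq flip: power_mult) (metis mult.commute power_mult)

lemma \<alpha>_nonzero: "\<alpha> \<noteq> 0"
  using \<alpha>_notin odd_q by (auto simp: K_eq zero_power odd_pos)

lemma \<alpha>_square_in: "\<alpha> ^ 2 \<in> K"
  using \<alpha>_power by (simp add: K_eq power_mult_distrib flip: power_mult)
    (metis mult.commute power2_minus power_mult)

text \<open>Links the norm in the denominator of \<Delta> to the \<open>\<alpha> ^ 2\<close> in the
  quadratic.\<close>

lemma \<alpha>_norm: "\<alpha> ^ (q + 1) = - (\<alpha> ^ 2)"
  using \<alpha>_power by (simp add: power2_eq_square)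

section \<open>The Cayley parametrization\<close>

text \<open>A zero would put \<alpha>, as \<open>1 / t\<close> or its negative, into
  \<open>K\<close>.\<close>

lemma nonzero_denominators:
  assumes "t \<in> K"
  shows "1 - t * \<alpha> \<noteq> 0" "1 + t * \<alpha> \<noteq> 0"
proof -
  have one: "1 \<in> K" by (simp add: K_eq)
  show "1 - t * \<alpha> \<noteq> 0"
  proof
    assume "1 - t * \<alpha> = 0"
    hence "\<alpha> = 1 / t" by (cases "t = 0") (auto simp: field_simps)
    thus False using \<alpha>_notin arith_in(4)[OF one assms] by simp
  qed
  show "1 + t * \<alpha> \<noteq> 0"
  proof
    assume *: "1 + t * \<alpha> = 0"
    hence "t \<noteq> 0" by auto
    moreover have "t * \<alpha> = - 1" using * by (metis add.commute add_eq_0_iff)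
    ultimately have "\<alpha> = - (1 / t)" by (simp add: field_simps)
    thus False using \<alpha>_notin uminus_in[OF arith_in(4)[OF one assms]] by simp
  qed
qed

text \<open>Conjugation fixes \<open>t\<close> and negates \<alpha>, so it swaps numerator and
  denominator; the q-th power is thus the inverse.\<close>

lemma power_q_cayley:
  assumes "t \<in> K"
  shows "((1 + t * \<alpha>) / (1 - t * \<alpha>)) ^ q = (1 - t * \<alpha>) / (1 + t * \<alpha>)"
  using assms
  by (simp add: power_divide frobenius_add frobenius_diff power_mult_distrib \<alpha>_power K_eq)

lemma bij_betw_cayley:
  "bij_betw (\<lambda>t. (1 + t * \<alpha>) / (1 - t * \<alpha>)) K (mu (q + 1) - {- 1})"
proof (rule bij_betwI[where g = "\<lambda>x. (x - 1) / ((x + 1) * \<alpha>)"])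
  show "(\<lambda>t. (1 + t * \<alpha>) / (1 - t * \<alpha>)) \<in> K \<rightarrow> mu (q + 1) - {- 1}"
  proof
    fix t assume t: "t \<in> K"
    have "(1 + t * \<alpha>) / (1 - t * \<alpha>) \<noteq> - 1"
    proof
      assume "(1 + t * \<alpha>) / (1 - t * \<alpha>) = - 1"
      hence "1 + t * \<alpha> = - (1 - t * \<alpha>)"
        using nonzero_denominators[OF t] by (simp add: divide_eq_eq)
      hence "(2::'a) = 0" by (simp add: eq_neg_iff_add_eq_0)
      thus False using two_nonzero by simp
    qed
    moreover have "((1 + t * \<alpha>) / (1 - t * \<alpha>)) ^ (q + 1) = 1"
      using power_q_cayley[OF t] nonzero_denominators[OF t] by simp
    ultimately show "(1 + t * \<alpha>) / (1 - t * \<alpha>) \<in> mu (q + 1) - {- 1}"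
      by (simp add: mu_def)
  qed
next
  show "(\<lambda>x. (x - 1) / ((x + 1) * \<alpha>)) \<in> mu (q + 1) - {- 1} \<rightarrow> K"
  proof
    fix x :: 'a assume x: "x \<in> mu (q + 1) - {- 1}"
    hence 1: "x + 1 \<noteq> 0" by (auto simp: add_eq_0_iff2)
    have x0: "x \<noteq> 0" using x by (auto simp: mu_def)
    \<comment> \<open>On \<open>mu (q + 1)\<close> conjugation is inversion, which negates
      \<open>(x - 1) / (x + 1)\<close>. The sign cancels against that of
      \<open>\<alpha> ^ q\<close>, so the quotient is fixed.\<close>
    have xq: "x ^ q = 1 / x" using x x0 by (simp add: mu_def field_simps)
    have "((x - 1) / ((x + 1) * \<alpha>)) ^ q = (1 / x - 1) / ((1 / x + 1) * (- \<alpha>))"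
      by (simp add: power_divide power_mult_distrib frobenius_add frobenius_diff xq \<alpha>_power)
    also have "1 / x - 1 = - (x - 1) / x" using x0 by (simp add: field_simps)
    also have "1 / x + 1 = (x + 1) / x" using x0 by (simp add: field_simps)
    also have "- (x - 1) / x / ((x + 1) / x * (- \<alpha>)) = (x - 1) / ((x + 1) * \<alpha>)"
      using x0 1 \<alpha>_nonzero by simp (metis minus_diff_eq minus_divide_left)
    finally show "(x - 1) / ((x + 1) * \<alpha>) \<in> K" by (simp add: K_eq)
  qed
next
  fix t assume t: "t \<in> K"
  let ?x = "(1 + t * \<alpha>) / (1 - t * \<alpha>)"
  \<comment> \<open>Over the common denominator the numerators are \<open>2 * (t * \<alpha>)\<close>
    and 2, whose quotient recovers \<open>t * \<alpha>\<close>.\<close>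
  have "?x - 1 = ((1 + t * \<alpha>) - (1 - t * \<alpha>)) / (1 - t * \<alpha>)"
    "?x + 1 = ((1 + t * \<alpha>) + (1 - t * \<alpha>)) / (1 - t * \<alpha>)"
    using nonzero_denominators[OF t]
    by (simp_all only: diff_divide_distrib[of _ "1 - t * \<alpha>" "1 - t * \<alpha>"]
        add_divide_distrib[of _ "1 - t * \<alpha>"]
        divide_self not_False_eq_True)
  hence "?x - 1 = 2 * (t * \<alpha>) / (1 - t * \<alpha>)" "?x + 1 = 2 / (1 - t * \<alpha>)"
    by simp_all
  thus "(?x - 1) / ((?x + 1) * \<alpha>) = t"
    using nonzero_denominators[OF t] \<alpha>_nonzero two_nonzero by simp
next
  fix x :: 'a assume "x \<in> mu (q + 1) - {- 1}"
  hence x: "x + 1 \<noteq> 0" by (auto simp: add_eq_0_iff2)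
  have t: "(x - 1) / ((x + 1) * \<alpha>) * \<alpha> = (x - 1) / (x + 1)" using \<alpha>_nonzero by simp
  have "1 + (x - 1) / (x + 1) = 2 * x / (x + 1)" "1 - (x - 1) / (x + 1) = 2 / (x + 1)"
    using x by (simp_all add: diff_divide_eq_iff add_divide_eq_iff divide_diff_eq_iff divide_add_eq_iff)
  thus "(1 + (x - 1) / ((x + 1) * \<alpha>) * \<alpha>) / (1 - (x - 1) / ((x + 1) * \<alpha>) * \<alpha>) = x"
    unfolding t using x two_nonzero by simp
qed

section \<open>From the trace equation to square roots of \<Delta>\<close>

text \<open>Conjugation turns the trace into an explicit sum of fractions. Multiplying by the
  nonzero \<open>?u * ?v\<close>, which is \<open>1 - t ^ 2 * \<alpha> ^ 2\<close>, gives minus the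
  quadratic.\<close>

lemma trace_cayley:
  assumes t: "t \<in> K" and "b1 \<in> K" "b2 \<in> K"
  shows "Tr q ((b1 + b2 * \<alpha>) * ((1 + t * \<alpha>) / (1 - t * \<alpha>)) + (b1 + b2 * \<alpha>)) + c = 0 \<longleftrightarrow>
    c * \<alpha> ^ 2 * t ^ 2 - 4 * b2 * \<alpha> ^ 2 * t - (4 * b1 + c) = 0"
proof -
  let ?u = "1 - t * \<alpha>" and ?v = "1 + t * \<alpha>"
  note nz = nonzero_denominators[OF t]
  have "Tr q ((b1 + b2 * \<alpha>) * (?v / ?u) + (b1 + b2 * \<alpha>))
      = (b1 + b2 * \<alpha>) * (?v / ?u) + (b1 + b2 * \<alpha>) + ((b1 - b2 * \<alpha>) * (?u / ?v) + (b1 - b2 * \<alpha>))"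
    using assms unfolding Tr_def
    by (simp only: frobenius_add power_mult_distrib power_q_cayley[OF t] \<alpha>_power K_eq mem_Collect_eq) simp
  moreover have "(?u * ?v) * \<dots> = 4 * (b1 + b2 * \<alpha> ^ 2 * t)"
  proof -
    \<comment> \<open>Here \<open>?u + ?v\<close> equals 2, and the terms odd in \<alpha> cancel
      between the two conjugate summands.\<close>
    have "(?u * ?v) * ((b1 + b2 * \<alpha>) * (?v / ?u) + (b1 + b2 * \<alpha>)
        + ((b1 - b2 * \<alpha>) * (?u / ?v) + (b1 - b2 * \<alpha>)))
      = (b1 + b2 * \<alpha>) * ?v * (?v + ?u) + (b1 - b2 * \<alpha>) * ?u * (?u + ?v)"
    proof -
      \<comment> \<open>Arbitrary nonzero \<open>u\<close> and \<open>v\<close> let the fractions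
        clear without expansion in \<open>t\<close> and \<alpha>.\<close>
      have gen: "(u * v) * (x * (v / u) + x + (y * (u / v) + y)) = x * v * (v + u) + y * u * (u + v)"
        if "u \<noteq> 0" "v \<noteq> 0" for u v x y :: 'a
        using that by (simp add: field_simps)
      show ?thesis by (rule gen[OF nz])
    qed
    thus ?thesis by (simp add: algebra_simps power2_eq_square)
  qed
  ultimately have "(?u * ?v) * (Tr q ((b1 + b2 * \<alpha>) * (?v / ?u) + (b1 + b2 * \<alpha>)) + c)
      = - (c * \<alpha> ^ 2 * t ^ 2 - 4 * b2 * \<alpha> ^ 2 * t - (4 * b1 + c))"
    by (simp add: distrib_left) (simp add: algebra_simps power2_eq_square)
  thus ?thesis using nz by (metis mult_eq_0_iff neg_equal_0_iff_equal)
qed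

lemma N_eq_card_roots:
  assumes "b1 \<in> K" "b2 \<in> K"
  shows "N q (b1 + b2 * \<alpha>) c
    = card {t \<in> K. c * \<alpha> ^ 2 * t ^ 2 - 4 * b2 * \<alpha> ^ 2 * t - (4 * b1 + c) = 0}"
proof -
  let ?f = "\<lambda>t. (1 + t * \<alpha>) / (1 - t * \<alpha>)"
  let ?T = "{t \<in> K. c * \<alpha> ^ 2 * t ^ 2 - 4 * b2 * \<alpha> ^ 2 * t - (4 * b1 + c) = 0}"
  have im: "?f ` K = mu (q + 1) - {- 1}" and inj: "inj_on ?f K"
    using bij_betw_cayley by (auto simp: bij_betw_def)
  have "{x \<in> mu (q + 1) - {- 1}. Tr q ((b1 + b2 * \<alpha>) * x + (b1 + b2 * \<alpha>)) + c = 0} = ?f ` ?T"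
    unfolding im[symmetric] using trace_cayley[OF _ assms] by blast
  moreover have "card (?f ` ?T) = card ?T"
    by (rule card_image, rule inj_on_subset[OF inj]) auto
  ultimately show ?thesis by (simp add: N_def)
qed

text \<open>For nonzero \<open>c\<close> the map \<open>?s\<close> is an affine bijection of
  \<open>K\<close>, and the quadratic times \<open>c\<close> equals
  \<open>4 * \<alpha> ^ 2 * (s ^ 2 - \<Delta>)\<close>.\<close>

lemma N_eq_card_square_roots:
  assumes "b1 \<in> K" "b2 \<in> K" "c \<in> K" "c \<noteq> 0"
  shows "N q (b1 + b2 * \<alpha>) c
    = card {s \<in> K. s ^ 2 = b2 ^ 2 - (c ^ 2 + 4 * c * b1) / (4 * \<alpha> ^ (q + 1))}"
proof -
  let ?\<Delta> = "b2 ^ 2 - (c ^ 2 + 4 * c * b1) / (4 * \<alpha> ^ (q + 1))"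
  let ?Q = "\<lambda>t. c * \<alpha> ^ 2 * t ^ 2 - 4 * b2 * \<alpha> ^ 2 * t - (4 * b1 + c)"
  let ?s = "\<lambda>t. (c * t - 2 * b2) / 2"
  \<comment> \<open>The minus sign in \<Delta> turns into plus because the norm of \<alpha> is
    \<open>- (\<alpha> ^ 2)\<close>.\<close>
  have \<Delta>: "?\<Delta> * (4 * \<alpha> ^ 2) = 4 * \<alpha> ^ 2 * b2 ^ 2 + c ^ 2 + 4 * c * b1"
    using \<alpha>_nonzero four_nonzero unfolding \<alpha>_norm by (simp add: field_simps)
  have s4: "?s t ^ 2 * (4 * \<alpha> ^ 2) = \<alpha> ^ 2 * (c * t - 2 * b2) ^ 2" for t
    using four_nonzero by (simp add: power_divide)
  have eq: "?Q t = 0 \<longleftrightarrow> ?s t ^ 2 = ?\<Delta>" for t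
  proof -
    have "(?s t ^ 2 - ?\<Delta>) * (4 * \<alpha> ^ 2) 
        = ?s t ^ 2 * (4 * \<alpha> ^ 2) - ?\<Delta> * (4 * \<alpha> ^ 2)"
      by (rule left_diff_distrib)
    also have "\<dots> = c * ?Q t"
      unfolding \<Delta> s4 by (simp add: algebra_simps power2_eq_square)
    finally show ?thesis using \<open>c \<noteq> 0\<close> four_nonzero \<alpha>_nonzero
      by (metis eq_iff_diff_eq_0 mult_eq_0_iff power_not_zero)
  qed
  have "bij_betw ?s {t \<in> K. ?Q t = 0} {s \<in> K. s ^ 2 = ?\<Delta>}"
  proof (rule bij_betwI[where g = "\<lambda>s. (2 * s + 2 * b2) / c"])
    show "?s \<in> {t \<in> K. ?Q t = 0} \<rightarrow> {s \<in> K. s ^ 2 = ?\<Delta>}"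
    proof
      fix t assume "t \<in> {t \<in> K. ?Q t = 0}"
      hence t: "t \<in> K" and "?s t ^ 2 = ?\<Delta>" unfolding eq by auto
      moreover have "?s t \<in> K" by (rule t assms two_in arith_in)+
      ultimately show "?s t \<in> {s \<in> K. s ^ 2 = ?\<Delta>}" by blast
    qed
    show "(\<lambda>s. (2 * s + 2 * b2) / c) \<in> {s \<in> K. s ^ 2 = ?\<Delta>} \<rightarrow> {t \<in> K. ?Q t = 0}"
    proof
      fix s assume "s \<in> {s \<in> K. s ^ 2 = ?\<Delta>}"
      hence s: "s \<in> K" "s ^ 2 = ?\<Delta>" by auto
      let ?t = "(2 * s + 2 * b2) / c"
      have "?s ?t = s" using \<open>c \<noteq> 0\<close> two_nonzero by simp
      hence "?Q ?t = 0" unfolding eq by (simp only: s(2))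
      moreover have "?t \<in> K" by (rule s(1) assms two_in arith_in)+
      ultimately show "?t \<in> {t \<in> K. ?Q t = 0}" by blast
    qed
  qed (use \<open>c \<noteq> 0\<close> two_nonzero in \<open>auto simp: field_simps\<close>)
  thus ?thesis unfolding N_eq_card_roots[OF assms(1,2)] by (rule bij_betw_same_card)
qed

lemma \<Delta>_in:
  assumes "b1 \<in> K" "b2 \<in> K" "c \<in> K"
  shows "b2 ^ 2 - (c ^ 2 + 4 * c * b1) / (4 * \<alpha> ^ (q + 1)) \<in> K"
  unfolding \<alpha>_norm by (rule assms four_in \<alpha>_square_in power_in uminus_in arith_in)+

section \<open>The cases \<open>c = 0\<close> and \<open>b = 0\<close>\<close>

text \<open>The only square roots of \<open>\<alpha> ^ 2\<close> in the whole field are \<alpha> and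
  its negative, both outside \<open>K\<close>.\<close>

lemma \<alpha>_square_no_root:
  assumes "s \<in> K"
  shows "s ^ 2 \<noteq> \<alpha> ^ 2"
  using assms \<alpha>_notin uminus_in[OF assms] by (auto simp: power2_eq_iff)

lemma coords_eq_0:
  assumes "b1 \<in> K" "b2 \<in> K" "b1 + b2 * \<alpha> = 0"
  shows "b1 = 0" "b2 = 0"
proof -
  show "b2 = 0"
  proof (rule ccontr)
    assume "b2 \<noteq> 0"
    hence "\<alpha> = - b1 / b2" using assms(3) by (simp add: field_simps add_eq_0_iff)
    thus False using \<alpha>_notin arith_in(4)[OF uminus_in] assms(1,2) by simp
  qed
  thus "b1 = 0" using assms by simp
qed

text \<open>At \<open>c = 0\<close> the quadratic degenerates to
  \<open>b2 * \<alpha> ^ 2 * t + b1 = 0\<close>, up to the factor -4: an identity, a contradiction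
  or one root.\<close>

lemma N_linear:
  assumes "b1 \<in> K" "b2 \<in> K"
  shows "b1 + b2 * \<alpha> = 0 \<Longrightarrow> N q (b1 + b2 * \<alpha>) 0 = card K"
    and "b1 + b2 * \<alpha> \<noteq> 0 \<Longrightarrow> b2 = 0 \<Longrightarrow> N q (b1 + b2 * \<alpha>) 0 = 0"
    and "b2 \<noteq> 0 \<Longrightarrow> N q (b1 + b2 * \<alpha>) 0 = 1"
proof -
  note N0 = N_eq_card_roots[OF assms, of 0]
  show "N q (b1 + b2 * \<alpha>) 0 = card K" if "b1 + b2 * \<alpha> = 0"
    unfolding N0 using coords_eq_0[OF assms that] by simp
  show "N q (b1 + b2 * \<alpha>) 0 = 0" if "b1 + b2 * \<alpha> \<noteq> 0" "b2 = 0"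
    unfolding N0 using that four_nonzero by simp
  show "N q (b1 + b2 * \<alpha>) 0 = 1" if "b2 \<noteq> 0"
  proof -
    have nz: "4 * b2 * \<alpha> ^ 2 \<noteq> 0" using that four_nonzero \<alpha>_nonzero by simp
    let ?t = "- (4 * b1) / (4 * b2 * \<alpha> ^ 2)"
    have "?t \<in> K" by (rule assms four_in \<alpha>_square_in uminus_in arith_in)+
    moreover have "0 * \<alpha> ^ 2 * t ^ 2 - 4 * b2 * \<alpha> ^ 2 * t - (4 * b1 + 0) = 0 \<longleftrightarrow> t = ?t" for t
      unfolding eq_divide_eq using nz by (simp add: algebra_simps) (metis minus_equation_iff)
    ultimately have "{t \<in> K. 0 * \<alpha> ^ 2 * t ^ 2 - 4 * b2 * \<alpha> ^ 2 * t - (4 * b1 + 0) = 0} = {?t}"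
      by auto
    thus ?thesis unfolding N0 by simp
  qed
qed

text \<open>The equation reduces to \<open>t ^ 2 * \<alpha> ^ 2 = 1\<close>, which would make
  \<open>1 / t\<close> a square root of \<open>\<alpha> ^ 2\<close> in \<open>K\<close>.\<close>

lemma N_zero_nonzero:
  assumes "c \<in> K" "c \<noteq> 0"
  shows "N q 0 c = 0"
proof -
  have z: "0 \<in> K" using odd_q by (simp add: K_eq zero_power odd_pos)
  have "t ^ 2 * \<alpha> ^ 2 \<noteq> 1" if "t \<in> K" for t
  proof -
    have "(1 / t) ^ 2 \<noteq> \<alpha> ^ 2"
      by (intro \<alpha>_square_no_root arith_in that) (simp add: K_eq)
    \<comment> \<open>At \<open>t = 0\<close> the convention \<open>1 / 0 = 0\<close> makes the
      preceding fact uninformative; there the claim is just that 0 differs from 1.\<close>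
    thus ?thesis by (cases "t = 0") (auto simp: field_simps)
  qed
  moreover have "c * \<alpha> ^ 2 * t ^ 2 - 4 * 0 * \<alpha> ^ 2 * t - (4 * 0 + c) = c * (t ^ 2 * \<alpha> ^ 2 - 1)" for t
    by (simp add: algebra_simps)
  ultimately have "{t \<in> K. c * \<alpha> ^ 2 * t ^ 2 - 4 * 0 * \<alpha> ^ 2 * t - (4 * 0 + c) = 0} = {}"
    using assms by auto
  thus ?thesis using N_eq_card_roots[OF z z, of c] by (simp only:) simp
qed

end

section \<open>The seven cases over the finite field\<close>

theorem theorem2:
  fixes p k q :: nat
    and Fq :: "'a::{field,finite} set"
    and \<alpha> b1 b2 b c \<Delta> :: 'a
  assumes "prime p" and "odd p"
    and "k \<ge> 1" and "q = p ^ k"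
    and "card (UNIV :: 'a set) = q ^ 2"
    and "is_subfield Fq" and "card Fq = q"
    and "\<alpha> \<notin> Fq" and "Tr q \<alpha> = 0"
    and "b1 \<in> Fq" and "b2 \<in> Fq" and "c \<in> Fq"
    and "b = b1 + b2 * \<alpha>"
    and "\<Delta> = b2 ^ 2 - (c ^ 2 + 4 * c * b1) / (4 * \<alpha> ^ (q + 1))"
  shows "\<Delta> \<in> Fq
    \<and> (b = 0 \<and> c = 0 \<longrightarrow> N q b c = q)
    \<and> (b = 0 \<and> c \<noteq> 0 \<longrightarrow> N q b c = 0)
    \<and> (b \<noteq> 0 \<and> c = 0 \<and> b2 = 0 \<longrightarrow> N q b c = 0)
    \<and> (b \<noteq> 0 \<and> c = 0 \<and> b2 \<noteq> 0 \<longrightarrow> N q b c = 1)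
    \<and> (b \<noteq> 0 \<and> c \<noteq> 0 \<and> \<Delta> = 0 \<longrightarrow> N q b c = 1)
    \<and> (b \<noteq> 0 \<and> c \<noteq> 0 \<and> \<Delta> \<in> Fq - {0} \<and> \<not> is_unit_square Fq \<Delta> \<longrightarrow> N q b c = 0)
    \<and> (b \<noteq> 0 \<and> c \<noteq> 0 \<and> is_unit_square Fq \<Delta> \<longrightarrow> N q b c = 2)"
proof -
  have "card (UNIV :: 'a set) = p ^ (k * 2)" using assms by (simp add: power_mult)
  hence char: "CHAR('a) = p" using \<open>prime p\<close> by (rule CHAR_eq_of_card_prime_power[rotated])
  have two: "(2::'a) \<noteq> 0"
  proof
    assume "(2::'a) = 0"
    hence "p dvd 2" using char of_nat_eq_0_iff_char_dvd[of 2, where ?'a = 'a] by simp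
    thus False using \<open>prime p\<close> \<open>odd p\<close> by (metis primes_dvd_imp_eq two_is_prime_nat dvd_refl)
  qed
  interpret frobenius_field q Fq \<alpha>
  proof
    show "Fq = {x. x ^ q = x}"
      using subfield_eq_fixed_points[OF \<open>is_subfield Fq\<close>] \<open>card Fq = q\<close> by simp
    show "(x + y) ^ q = x ^ q + y ^ q" for x y :: 'a
      using \<open>prime p\<close> \<open>q = p ^ k\<close> char by (intro freshmans_dream') auto
    show "odd q" using \<open>odd p\<close> \<open>q = p ^ k\<close> by simp
    show "\<alpha> ^ q = - \<alpha>"
      using \<open>Tr q \<alpha> = 0\<close> by (simp add: Tr_def add_eq_0_iff)
  qed (use two \<open>\<alpha> \<notin> Fq\<close> in auto)
  note mem = \<open>b1 \<in> Fq\<close> \<open>b2 \<in> Fq\<close>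
  have "N q b c = card {s \<in> Fq. s ^ 2 = \<Delta>}" if "c \<noteq> 0"
    using N_eq_card_square_roots[OF mem \<open>c \<in> Fq\<close> that] assms by simp
  moreover have "\<Delta> \<in> Fq" using \<Delta>_in[OF mem \<open>c \<in> Fq\<close>] assms by simp
  \<comment> \<open>Cases with \<open>c = 0\<close> come from the linear equation,
    \<open>b = 0\<close> with nonzero \<open>c\<close> from \<open>N_zero_nonzero\<close>, and the
    other three from counting square roots of \<Delta>.\<close>
  ultimately show ?thesis
    using N_linear[OF mem] N_zero_nonzero[OF \<open>c \<in> Fq\<close>] \<open>card Fq = q\<close> \<open>b = b1 + b2 * \<alpha>\<close>
      card_square_roots[OF \<open>is_subfield Fq\<close> two, of \<Delta>] by auto
qed

end
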